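(* Let $R$ be a ring, let $n\geq 1$ be an integer and let $S:=\mathrm{M}_n(R)$ be the ring of $n\times n$ matrices over $R$. If $S/R$ is h-separable, then either $n=1$ or $R=0$.
   Context: A functor $F:\mathcal{B}\to\mathcal{A}$ is h-separable (heavily separable) if there are maps $P_{X,Y}:\mathrm{Hom}_{\mathcal{A}}(FX,FY)\to\mathrm{Hom}_{\mathcal{B}}(X,Y)$, natural in $X,Y\in\mathcal{B}$, such that $P_{X,Y}(Ff)=f$ for every $f:X\to Y$ in $\mathcal{B}$, and $P_{X,Z}(f\circ g)=P_{Y,Z}(f)\circ P_{X,Y}(g)$ for all $X,Y,Z\in\mathcal{B}$ and all $g:FX\to FY$, $f:FY\to FZ$ in $\mathcal{A}$. Rings are associative and unital (not necessarily commutative), and ring homomorphisms are unital. Given a ring homomorphism $\varphi:R\to S$, $S/R$ is called h-separable if the restriction of scalars functor $\varphi_{\ast}:S\text{-}\mathrm{Mod}\to R\text{-}\mathrm{Mod}$ (left modules) is h-separable. Here $\varphi:R\to\mathrm{M}_n(R)$ is the canonical map sending $r$ to the diagonal matrix with all diagonal entries equal to $r$. *)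

theory Defs
  imports "Jordan_Normal_Form.Matrix" "HOL-Algebra.Module" "HOL-Library.FuncSet"
begin

section \<open>Categories, functors, heavy separability\<close>

text \<open>Hom-sets need not be disjoint, so composition and the action of a functor on
  morphisms take the objects as arguments: \<open>comp C X Y Z g f\<close> is
  \<open>g \<circ> f\<close> for \<open>f : X \<rightarrow> Y\<close> and \<open>g : Y \<rightarrow> Z\<close>.\<close>

record ('o, 'm) cat =
  obj :: "'o set"
  arr :: "'o \<Rightarrow> 'o \<Rightarrow> 'm set"
  ident :: "'o \<Rightarrow> 'm"
  comp :: "'o \<Rightarrow> 'o \<Rightarrow> 'o \<Rightarrow> 'm \<Rightarrow> 'm \<Rightarrow> 'm"

definition is_category :: "('o, 'm) cat \<Rightarrow> bool" where
  "is_category C \<longleftrightarrow>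
     (\<forall>X\<in>obj C. ident C X \<in> arr C X X) \<and>
     (\<forall>X\<in>obj C. \<forall>Y\<in>obj C. \<forall>Z\<in>obj C. \<forall>f\<in>arr C X Y. \<forall>g\<in>arr C Y Z.
        comp C X Y Z g f \<in> arr C X Z) \<and>
     (\<forall>X\<in>obj C. \<forall>Y\<in>obj C. \<forall>f\<in>arr C X Y.
        comp C X X Y f (ident C X) = f \<and> comp C X Y Y (ident C Y) f = f) \<and>
     (\<forall>W\<in>obj C. \<forall>X\<in>obj C. \<forall>Y\<in>obj C. \<forall>Z\<in>obj C.
        \<forall>f\<in>arr C W X. \<forall>g\<in>arr C X Y. \<forall>h\<in>arr C Y Z.
        comp C W Y Z h (comp C W X Y g f) = comp C W X Z (comp C X Y Z h g) f)"

record ('o1, 'm1, 'o2, 'm2) func =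
  fobj :: "'o1 \<Rightarrow> 'o2"
  farr :: "'o1 \<Rightarrow> 'o1 \<Rightarrow> 'm1 \<Rightarrow> 'm2"

definition is_functor ::
  "('o1, 'm1) cat \<Rightarrow> ('o2, 'm2) cat \<Rightarrow> ('o1, 'm1, 'o2, 'm2) func \<Rightarrow> bool" where
  "is_functor B A F \<longleftrightarrow> is_category B \<and> is_category A \<and>
     (\<forall>X\<in>obj B. fobj F X \<in> obj A) \<and>
     (\<forall>X\<in>obj B. \<forall>Y\<in>obj B. \<forall>f\<in>arr B X Y. farr F X Y f \<in> arr A (fobj F X) (fobj F Y)) \<and>
     (\<forall>X\<in>obj B. farr F X X (ident B X) = ident A (fobj F X)) \<and>
     (\<forall>X\<in>obj B. \<forall>Y\<in>obj B. \<forall>Z\<in>obj B. \<forall>f\<in>arr B X Y. \<forall>g\<in>arr B Y Z.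
        farr F X Z (comp B X Y Z g f) =
          comp A (fobj F X) (fobj F Y) (fobj F Z) (farr F Y Z g) (farr F X Y f))"

text \<open>The four conjuncts about \<open>P\<close>: it maps between the right hom-sets, it is natural in
  both variables (\<open>P (F k \<circ> f \<circ> F h) = k \<circ> P f \<circ> h\<close>),
  it is a retraction of \<open>F\<close>, and it preserves composition.\<close>

definition h_separable_functor ::
  "('o1, 'm1) cat \<Rightarrow> ('o2, 'm2) cat \<Rightarrow> ('o1, 'm1, 'o2, 'm2) func \<Rightarrow> bool" where
  "h_separable_functor B A F \<longleftrightarrow> is_functor B A F \<and>
    (\<exists>P :: 'o1 \<Rightarrow> 'o1 \<Rightarrow> 'm2 \<Rightarrow> 'm1.
      (\<forall>X\<in>obj B. \<forall>Y\<in>obj B. \<forall>f\<in>arr A (fobj F X) (fobj F Y). P X Y f \<in> arr B X Y) \<and>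
      (\<forall>X'\<in>obj B. \<forall>X\<in>obj B. \<forall>Y\<in>obj B. \<forall>Y'\<in>obj B.
         \<forall>h\<in>arr B X' X. \<forall>f\<in>arr A (fobj F X) (fobj F Y). \<forall>k\<in>arr B Y Y'.
         P X' Y' (comp A (fobj F X') (fobj F Y) (fobj F Y') (farr F Y Y' k)
                    (comp A (fobj F X') (fobj F X) (fobj F Y) f (farr F X' X h)))
         = comp B X' Y Y' k (comp B X' X Y (P X Y f) h)) \<and>
      (\<forall>X\<in>obj B. \<forall>Y\<in>obj B. \<forall>f\<in>arr B X Y. P X Y (farr F X Y f) = f) \<and>
      (\<forall>X\<in>obj B. \<forall>Y\<in>obj B. \<forall>Z\<in>obj B.
         \<forall>g\<in>arr A (fobj F X) (fobj F Y). \<forall>f\<in>arr A (fobj F Y) (fobj F Z).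
         P X Z (comp A (fobj F X) (fobj F Y) (fobj F Z) f g)
         = comp B X Y Z (P Y Z f) (P X Y g)))"


section \<open>Left modules and restriction of scalars\<close>

text \<open>The library locale \<open>module\<close> with \<open>ring\<close> in place of \<open>cring\<close>. (The fields
  \<open>mult\<close> and \<open>one\<close> of a module record are not part of the module structure.)\<close>

locale left_module = R?: ring + M?: abelian_group M for M (structure) +
  assumes smult_closed [simp, intro]:
      "\<lbrakk>a \<in> carrier R; x \<in> carrier M\<rbrakk> \<Longrightarrow> a \<odot>\<^bsub>M\<^esub> x \<in> carrier M"
    and smult_l_distr:
      "\<lbrakk>a \<in> carrier R; b \<in> carrier R; x \<in> carrier M\<rbrakk> \<Longrightarrow>
       (a \<oplus> b) \<odot>\<^bsub>M\<^esub> x = a \<odot>\<^bsub>M\<^esub> x \<oplus>\<^bsub>M\<^esub> b \<odot>\<^bsub>M\<^esub> x"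
    and smult_r_distr:
      "\<lbrakk>a \<in> carrier R; x \<in> carrier M; y \<in> carrier M\<rbrakk> \<Longrightarrow>
       a \<odot>\<^bsub>M\<^esub> (x \<oplus>\<^bsub>M\<^esub> y) = a \<odot>\<^bsub>M\<^esub> x \<oplus>\<^bsub>M\<^esub> a \<odot>\<^bsub>M\<^esub> y"
    and smult_assoc1:
      "\<lbrakk>a \<in> carrier R; b \<in> carrier R; x \<in> carrier M\<rbrakk> \<Longrightarrow>
       (a \<otimes> b) \<odot>\<^bsub>M\<^esub> x = a \<odot>\<^bsub>M\<^esub> (b \<odot>\<^bsub>M\<^esub> x)"
    and smult_one [simp]:
      "x \<in> carrier M \<Longrightarrow> \<one> \<odot>\<^bsub>M\<^esub> x = x"

text \<open>Linear maps are extensional functions on the carrier, so that equality of morphisms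
  is equality of functions.\<close>

definition lmod_hom ::
  "('r, 'c) ring_scheme \<Rightarrow> ('r, 'm) module \<Rightarrow> ('r, 'm) module \<Rightarrow> ('m \<Rightarrow> 'm) set" where
  "lmod_hom R M N = {f \<in> carrier M \<rightarrow>\<^sub>E carrier N.
     (\<forall>x\<in>carrier M. \<forall>y\<in>carrier M. f (x \<oplus>\<^bsub>M\<^esub> y) = f x \<oplus>\<^bsub>N\<^esub> f y) \<and>
     (\<forall>a\<in>carrier R. \<forall>x\<in>carrier M. f (a \<odot>\<^bsub>M\<^esub> x) = a \<odot>\<^bsub>N\<^esub> f x)}"

text \<open>The category \<open>R-Mod\<close> of left \<open>R\<close>-modules whose carrier lives in the type
  \<open>'m\<close>; this type plays the role of the universe of the category.\<close>

definition LMod :: "('r, 'c) ring_scheme \<Rightarrow> (('r, 'm) module, 'm \<Rightarrow> 'm) cat" where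
  "LMod R = \<lparr>obj = {M. left_module R M},
     arr = lmod_hom R,
     ident = (\<lambda>M. \<lambda>x\<in>carrier M. x),
     comp = (\<lambda>L M N g f. compose (carrier L) g f)\<rparr>"

definition restrict_module :: "('r \<Rightarrow> 's) \<Rightarrow> ('s, 'm) module \<Rightarrow> ('r, 'm) module" where
  "restrict_module \<phi> M = \<lparr>carrier = carrier M, mult = mult M, one = one M,
     zero = zero M, add = add M, smult = (\<lambda>r x. \<phi> r \<odot>\<^bsub>M\<^esub> x)\<rparr>"

definition restrict_scalars ::
  "('r \<Rightarrow> 's) \<Rightarrow> (('s, 'm) module, 'm \<Rightarrow> 'm, ('r, 'm) module, 'm \<Rightarrow> 'm) func" where
  "restrict_scalars \<phi> = \<lparr>fobj = restrict_module \<phi>, farr = (\<lambda>M N f. f)\<rparr>"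

definition h_separable_ext ::
  "'m itself \<Rightarrow> ('r, 'c) ring_scheme \<Rightarrow> ('s, 'd) ring_scheme \<Rightarrow> ('r \<Rightarrow> 's) \<Rightarrow> bool" where
  "h_separable_ext U R S \<phi> \<longleftrightarrow>
     h_separable_functor
       (LMod S :: (('s, 'm) module, 'm \<Rightarrow> 'm) cat)
       (LMod R :: (('r, 'm) module, 'm \<Rightarrow> 'm) cat)
       (restrict_scalars \<phi>)"

text \<open>A type \<open>'m\<close> is large enough to serve as universe for modules over \<open>R\<close> if the
  finite sequences of elements of \<open>R\<close> embed into it; then \<open>LMod\<close> contains, up to
  isomorphism, all finitely generated modules over \<open>R\<close> and over its matrix rings. Any
  set-theoretic universe containing \<open>R\<close> has this property, whereas over, say, a one-element
  type there are only zero modules.\<close>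

definition large_universe :: "'m itself \<Rightarrow> ('r, 'c) ring_scheme \<Rightarrow> bool" where
  "large_universe U R \<longleftrightarrow> (\<exists>e :: 'r list \<Rightarrow> 'm. inj_on e (lists (carrier R)))"


section \<open>Matrix rings\<close>

text \<open>The library's \<open>ring_mat\<close> needs the entries to form a type of class
  \<open>semiring_1\<close>, which excludes the zero ring.\<close>

definition matrix_ring :: "('r, 'c) ring_scheme \<Rightarrow> nat \<Rightarrow> 'r mat ring" where
  "matrix_ring R n = \<lparr>
     carrier = {A \<in> carrier_mat n n. elements_mat A \<subseteq> carrier R},
     mult = (\<lambda>A B. mat n n (\<lambda>(i,j). \<Oplus>\<^bsub>R\<^esub>k\<in>{..<n}. A $$ (i,k) \<otimes>\<^bsub>R\<^esub> B $$ (k,j))),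
     one = mat n n (\<lambda>(i,j). if i = j then \<one>\<^bsub>R\<^esub> else \<zero>\<^bsub>R\<^esub>),
     zero = mat n n (\<lambda>(i,j). \<zero>\<^bsub>R\<^esub>),
     add = (\<lambda>A B. mat n n (\<lambda>(i,j). A $$ (i,j) \<oplus>\<^bsub>R\<^esub> B $$ (i,j)))\<rparr>"

definition scalar_matrix :: "('r, 'c) ring_scheme \<Rightarrow> nat \<Rightarrow> 'r \<Rightarrow> 'r mat" where
  "scalar_matrix R n r = mat n n (\<lambda>(i,j). if i = j then r else \<zero>\<^bsub>R\<^esub>)"


section \<open>The constructions are well defined\<close>

lemma lmod_hom_compose:
  assumes "left_module R L" "f \<in> lmod_hom R L M" "g \<in> lmod_hom R M N"
  shows "compose (carrier L) g f \<in> lmod_hom R L N"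
proof -
  interpret L: left_module R L by fact
  show ?thesis
    using assms(2,3) unfolding lmod_hom_def
    by (auto simp: compose_def PiE_iff)
qed

lemma lmod_hom_ident:
  assumes "left_module R M"
  shows "(\<lambda>x\<in>carrier M. x) \<in> lmod_hom R M M"
proof -
  interpret M: left_module R M by fact
  show ?thesis unfolding lmod_hom_def by auto
qed

lemma is_category_LMod:
  fixes R :: "('r, 'c) ring_scheme"
  shows "is_category (LMod R :: (('r, 'm) module, 'm \<Rightarrow> 'm) cat)"
proof -
  have "compose (carrier M) f (\<lambda>x\<in>carrier M. x) = f \<and> compose (carrier M) (\<lambda>x\<in>carrier N. x) f = f"
    if "f \<in> lmod_hom R M N" for f and M N :: "('r, 'm) module"
  proof -
    have "f \<in> carrier M \<rightarrow>\<^sub>E carrier N" using that by (simp add: lmod_hom_def)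
    then show ?thesis
      by (auto simp: compose_def fun_eq_iff restrict_def PiE_iff extensional_def)
  qed
  moreover have "compose (carrier K) h (compose (carrier K) g f) = compose (carrier K) (compose (carrier L) h g) f"
    if "f \<in> lmod_hom R K L" for f g h and K L :: "('r, 'm) module"
    using that by (auto simp: lmod_hom_def compose_def fun_eq_iff restrict_def)
  ultimately show ?thesis
    unfolding is_category_def
    by (auto simp: LMod_def intro: lmod_hom_compose lmod_hom_ident)
qed

lemma left_module_restrict_module:
  assumes "ring R" "\<phi> \<in> ring_hom R S" "left_module S M"
  shows "left_module R (restrict_module \<phi> M)"
proof -
  interpret R: ring R by fact
  interpret M: left_module S M by fact
  have 1: "abelian_group (restrict_module \<phi> M)"
    by (rule abelian_groupI)
      (auto simp: restrict_module_def M.a_ac intro!: M.add.l_inv_ex[simplified])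
  show ?thesis
    using 1 assms(2)
    by (auto simp: left_module_def left_module_axioms_def restrict_module_def R.ring_axioms
        ring_hom_closed ring_hom_add ring_hom_mult ring_hom_one
        M.smult_l_distr M.smult_r_distr M.smult_assoc1)
qed

lemma is_functor_restrict_scalars:
  assumes "ring R" "\<phi> \<in> ring_hom R S"
  shows "is_functor (LMod S) (LMod R) (restrict_scalars \<phi>)"
  using left_module_restrict_module[OF assms] assms(2)
  unfolding is_functor_def
  by (auto simp: is_category_LMod) (auto simp: LMod_def restrict_scalars_def restrict_module_def
      lmod_hom_def ring_hom_closed)

lemma matrix_ring_carrier_iff:
  "A \<in> carrier (matrix_ring R n) \<longleftrightarrow>
     A \<in> carrier_mat n n \<and> (\<forall>i<n. \<forall>j<n. A $$ (i,j) \<in> carrier R)"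
  by (fastforce simp: matrix_ring_def elements_mat_def)

lemma matrix_ring_simps:
  "mult (matrix_ring R n) A B
     = mat n n (\<lambda>(i,j). \<Oplus>\<^bsub>R\<^esub>k\<in>{..<n}. A $$ (i,k) \<otimes>\<^bsub>R\<^esub> B $$ (k,j))"
  "one (matrix_ring R n) = mat n n (\<lambda>(i,j). if i = j then \<one>\<^bsub>R\<^esub> else \<zero>\<^bsub>R\<^esub>)"
  "zero (matrix_ring R n) = mat n n (\<lambda>(i,j). \<zero>\<^bsub>R\<^esub>)"
  "add (matrix_ring R n) A B = mat n n (\<lambda>(i,j). A $$ (i,j) \<oplus>\<^bsub>R\<^esub> B $$ (i,j))"
  by (simp_all add: matrix_ring_def)

lemma (in ring) finsum_scalar_left:
  fixes i n :: nat
  assumes "i < n" "a \<in> carrier R" "\<And>k. k < n \<Longrightarrow> f k \<in> carrier R"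
  shows "(\<Oplus>k\<in>{..<n}. (if i = k then a else \<zero>) \<otimes> f k) = a \<otimes> f i"
proof -
  have "(\<Oplus>k\<in>{..<n}. (if i = k then a else \<zero>) \<otimes> f k)
      = (\<Oplus>k\<in>{..<n}. if i = k then a \<otimes> f k else \<zero>)"
    by (rule add.finprod_cong') (use assms in auto)
  also have "\<dots> = a \<otimes> f i"
    by (rule add.finprod_singleton) (use assms in auto)
  finally show ?thesis .
qed

lemma (in ring) finsum_scalar_right:
  fixes i n :: nat
  assumes "i < n" "a \<in> carrier R" "\<And>k. k < n \<Longrightarrow> f k \<in> carrier R"
  shows "(\<Oplus>k\<in>{..<n}. f k \<otimes> (if k = i then a else \<zero>)) = f i \<otimes> a"
proof -
  have "(\<Oplus>k\<in>{..<n}. f k \<otimes> (if k = i then a else \<zero>))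
      = (\<Oplus>k\<in>{..<n}. if i = k then f k \<otimes> a else \<zero>)"
    by (rule add.finprod_cong') (use assms in auto)
  also have "\<dots> = f i \<otimes> a"
    by (rule add.finprod_singleton) (use assms in auto)
  finally show ?thesis .
qed

lemma ring_matrix_ring:
  fixes R (structure)
  assumes "ring R"
  shows "ring (matrix_ring R n)"
proof -
  interpret ring R by fact
  let ?S = "matrix_ring R n"
  have inv: "\<exists>B\<in>carrier ?S. B \<oplus>\<^bsub>?S\<^esub> A = \<zero>\<^bsub>?S\<^esub>" if "A \<in> carrier ?S" for A
    using that
    by (intro bexI[of _ "mat n n (\<lambda>(i,j). \<ominus> A $$ (i,j))"])
      (auto simp: matrix_ring_carrier_iff matrix_ring_simps l_neg intro!: eq_matI)
  have ab: "abelian_group ?S"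
  proof (rule abelian_groupI)
    fix A B C assume "A \<in> carrier ?S" "B \<in> carrier ?S" "C \<in> carrier ?S"
    then show "A \<oplus>\<^bsub>?S\<^esub> B \<oplus>\<^bsub>?S\<^esub> C = A \<oplus>\<^bsub>?S\<^esub> (B \<oplus>\<^bsub>?S\<^esub> C)"
      by (auto simp: matrix_ring_carrier_iff matrix_ring_simps a_assoc intro!: eq_matI)
  next
    fix A B assume "A \<in> carrier ?S" "B \<in> carrier ?S"
    then show "A \<oplus>\<^bsub>?S\<^esub> B = B \<oplus>\<^bsub>?S\<^esub> A"
      by (auto simp: matrix_ring_carrier_iff matrix_ring_simps a_comm intro!: eq_matI)
  qed (use inv in \<open>auto simp: matrix_ring_carrier_iff matrix_ring_simps intro!: eq_matI\<close>)
  have closed: "A \<otimes>\<^bsub>?S\<^esub> B \<in> carrier ?S" if "A \<in> carrier ?S" "B \<in> carrier ?S" for A B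
    using that by (auto simp: matrix_ring_carrier_iff matrix_ring_simps intro!: finsum_closed)
  have assoc: "(A \<otimes>\<^bsub>?S\<^esub> B) \<otimes>\<^bsub>?S\<^esub> C = A \<otimes>\<^bsub>?S\<^esub> (B \<otimes>\<^bsub>?S\<^esub> C)"
    if "A \<in> carrier ?S" "B \<in> carrier ?S" "C \<in> carrier ?S" for A B C
  proof (rule eq_matI)
    fix i j assume "i < dim_row (A \<otimes>\<^bsub>?S\<^esub> (B \<otimes>\<^bsub>?S\<^esub> C))" "j < dim_col (A \<otimes>\<^bsub>?S\<^esub> (B \<otimes>\<^bsub>?S\<^esub> C))"
    then have ij: "i < n" "j < n" by (simp_all add: matrix_ring_simps)
    note [simp] = that[unfolded matrix_ring_carrier_iff, THEN conjunct2, rule_format]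
    have "((A \<otimes>\<^bsub>?S\<^esub> B) \<otimes>\<^bsub>?S\<^esub> C) $$ (i,j)
        = (\<Oplus>k\<in>{..<n}. (\<Oplus>l\<in>{..<n}. A $$ (i,l) \<otimes> B $$ (l,k)) \<otimes> C $$ (k,j))"
      using ij by (auto simp: matrix_ring_simps intro!: add.finprod_cong' finsum_closed)
    also have "\<dots> = (\<Oplus>k\<in>{..<n}. \<Oplus>l\<in>{..<n}. A $$ (i,l) \<otimes> B $$ (l,k) \<otimes> C $$ (k,j))"
      using ij by (auto intro!: add.finprod_cong' finsum_closed finsum_ldistr)
    also have "\<dots> = (\<Oplus>l\<in>{..<n}. \<Oplus>k\<in>{..<n}. A $$ (i,l) \<otimes> B $$ (l,k) \<otimes> C $$ (k,j))"
      using ij by (intro finsum_finsum_swap) auto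
    also have "\<dots> = (\<Oplus>l\<in>{..<n}. \<Oplus>k\<in>{..<n}. A $$ (i,l) \<otimes> (B $$ (l,k) \<otimes> C $$ (k,j)))"
      using ij by (auto intro!: add.finprod_cong' finsum_closed simp: m_assoc)
    also have "\<dots> = (\<Oplus>l\<in>{..<n}. A $$ (i,l) \<otimes> (\<Oplus>k\<in>{..<n}. B $$ (l,k) \<otimes> C $$ (k,j)))"
      using ij by (auto intro!: add.finprod_cong' finsum_closed finsum_rdistr[symmetric])
    also have "\<dots> = (A \<otimes>\<^bsub>?S\<^esub> (B \<otimes>\<^bsub>?S\<^esub> C)) $$ (i,j)"
      using ij by (auto simp: matrix_ring_simps intro!: add.finprod_cong' finsum_closed)
    finally show "((A \<otimes>\<^bsub>?S\<^esub> B) \<otimes>\<^bsub>?S\<^esub> C) $$ (i,j) = (A \<otimes>\<^bsub>?S\<^esub> (B \<otimes>\<^bsub>?S\<^esub> C)) $$ (i,j)" .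
  qed (simp_all add: matrix_ring_simps)
  have l_one: "\<one>\<^bsub>?S\<^esub> \<otimes>\<^bsub>?S\<^esub> A = A" if "A \<in> carrier ?S" for A
  proof (rule eq_matI)
    fix i j assume "i < dim_row A" "j < dim_col A"
    then have ij: "i < n" "j < n" using that by (auto simp: matrix_ring_carrier_iff)
    have "(\<one>\<^bsub>?S\<^esub> \<otimes>\<^bsub>?S\<^esub> A) $$ (i,j) = (\<Oplus>k\<in>{..<n}. (if i = k then \<one> else \<zero>) \<otimes> A $$ (k,j))"
      using ij that by (auto simp: matrix_ring_simps matrix_ring_carrier_iff intro!: add.finprod_cong')
    also have "\<dots> = A $$ (i,j)"
      using ij that by (subst finsum_scalar_left) (auto simp: matrix_ring_carrier_iff)
    finally show "(\<one>\<^bsub>?S\<^esub> \<otimes>\<^bsub>?S\<^esub> A) $$ (i,j) = A $$ (i,j)" .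
  qed (use that in \<open>auto simp: matrix_ring_carrier_iff matrix_ring_simps\<close>)
  have r_one: "A \<otimes>\<^bsub>?S\<^esub> \<one>\<^bsub>?S\<^esub> = A" if "A \<in> carrier ?S" for A
  proof (rule eq_matI)
    fix i j assume "i < dim_row A" "j < dim_col A"
    then have ij: "i < n" "j < n" using that by (auto simp: matrix_ring_carrier_iff)
    have "(A \<otimes>\<^bsub>?S\<^esub> \<one>\<^bsub>?S\<^esub>) $$ (i,j) = (\<Oplus>k\<in>{..<n}. A $$ (i,k) \<otimes> (if k = j then \<one> else \<zero>))"
      using ij that by (auto simp: matrix_ring_simps matrix_ring_carrier_iff intro!: add.finprod_cong')
    also have "\<dots> = A $$ (i,j)"
      using ij that by (subst finsum_scalar_right) (auto simp: matrix_ring_carrier_iff)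
    finally show "(A \<otimes>\<^bsub>?S\<^esub> \<one>\<^bsub>?S\<^esub>) $$ (i,j) = A $$ (i,j)" .
  qed (use that in \<open>auto simp: matrix_ring_carrier_iff matrix_ring_simps\<close>)
  have mon: "Group.monoid ?S"
    by (rule monoidI)
      (auto simp: closed assoc l_one r_one, auto simp: matrix_ring_carrier_iff matrix_ring_simps)
  have l_distr': "(A \<oplus>\<^bsub>?S\<^esub> B) \<otimes>\<^bsub>?S\<^esub> C = A \<otimes>\<^bsub>?S\<^esub> C \<oplus>\<^bsub>?S\<^esub> B \<otimes>\<^bsub>?S\<^esub> C"
    if "A \<in> carrier ?S" "B \<in> carrier ?S" "C \<in> carrier ?S" for A B C
  proof (rule eq_matI)
    fix i j assume "i < dim_row (A \<otimes>\<^bsub>?S\<^esub> C \<oplus>\<^bsub>?S\<^esub> B \<otimes>\<^bsub>?S\<^esub> C)" "j < dim_col (A \<otimes>\<^bsub>?S\<^esub> C \<oplus>\<^bsub>?S\<^esub> B \<otimes>\<^bsub>?S\<^esub> C)"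
    then have ij: "i < n" "j < n" by (simp_all add: matrix_ring_simps)
    note [simp] = that[unfolded matrix_ring_carrier_iff, THEN conjunct2, rule_format]
    have "((A \<oplus>\<^bsub>?S\<^esub> B) \<otimes>\<^bsub>?S\<^esub> C) $$ (i,j) = (\<Oplus>k\<in>{..<n}. A $$ (i,k) \<otimes> C $$ (k,j) \<oplus> B $$ (i,k) \<otimes> C $$ (k,j))"
      using ij by (auto simp: matrix_ring_simps l_distr simp del: finsum_addf add.finprod_multf
          intro!: add.finprod_cong')
    also have "\<dots> = (\<Oplus>k\<in>{..<n}. A $$ (i,k) \<otimes> C $$ (k,j)) \<oplus> (\<Oplus>k\<in>{..<n}. B $$ (i,k) \<otimes> C $$ (k,j))"
      using ij by (intro finsum_addf) auto
    also have "\<dots> = (A \<otimes>\<^bsub>?S\<^esub> C \<oplus>\<^bsub>?S\<^esub> B \<otimes>\<^bsub>?S\<^esub> C) $$ (i,j)"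
      using ij by (simp add: matrix_ring_simps)
    finally show "((A \<oplus>\<^bsub>?S\<^esub> B) \<otimes>\<^bsub>?S\<^esub> C) $$ (i,j) = (A \<otimes>\<^bsub>?S\<^esub> C \<oplus>\<^bsub>?S\<^esub> B \<otimes>\<^bsub>?S\<^esub> C) $$ (i,j)" .
  qed (simp_all add: matrix_ring_simps)
  have r_distr': "C \<otimes>\<^bsub>?S\<^esub> (A \<oplus>\<^bsub>?S\<^esub> B) = C \<otimes>\<^bsub>?S\<^esub> A \<oplus>\<^bsub>?S\<^esub> C \<otimes>\<^bsub>?S\<^esub> B"
    if "A \<in> carrier ?S" "B \<in> carrier ?S" "C \<in> carrier ?S" for A B C
  proof (rule eq_matI)
    fix i j assume "i < dim_row (C \<otimes>\<^bsub>?S\<^esub> A \<oplus>\<^bsub>?S\<^esub> C \<otimes>\<^bsub>?S\<^esub> B)" "j < dim_col (C \<otimes>\<^bsub>?S\<^esub> A \<oplus>\<^bsub>?S\<^esub> C \<otimes>\<^bsub>?S\<^esub> B)"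
    then have ij: "i < n" "j < n" by (simp_all add: matrix_ring_simps)
    note [simp] = that[unfolded matrix_ring_carrier_iff, THEN conjunct2, rule_format]
    have "(C \<otimes>\<^bsub>?S\<^esub> (A \<oplus>\<^bsub>?S\<^esub> B)) $$ (i,j) = (\<Oplus>k\<in>{..<n}. C $$ (i,k) \<otimes> A $$ (k,j) \<oplus> C $$ (i,k) \<otimes> B $$ (k,j))"
      using ij by (auto simp: matrix_ring_simps r_distr simp del: finsum_addf add.finprod_multf
          intro!: add.finprod_cong')
    also have "\<dots> = (\<Oplus>k\<in>{..<n}. C $$ (i,k) \<otimes> A $$ (k,j)) \<oplus> (\<Oplus>k\<in>{..<n}. C $$ (i,k) \<otimes> B $$ (k,j))"
      using ij by (intro finsum_addf) auto
    also have "\<dots> = (C \<otimes>\<^bsub>?S\<^esub> A \<oplus>\<^bsub>?S\<^esub> C \<otimes>\<^bsub>?S\<^esub> B) $$ (i,j)"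
      using ij by (simp add: matrix_ring_simps)
    finally show "(C \<otimes>\<^bsub>?S\<^esub> (A \<oplus>\<^bsub>?S\<^esub> B)) $$ (i,j) = (C \<otimes>\<^bsub>?S\<^esub> A \<oplus>\<^bsub>?S\<^esub> C \<otimes>\<^bsub>?S\<^esub> B) $$ (i,j)" .
  qed (simp_all add: matrix_ring_simps)
  show ?thesis
    by (intro ringI ab mon l_distr' r_distr')
qed

lemma scalar_matrix_ring_hom:
  fixes R (structure)
  assumes "ring R"
  shows "scalar_matrix R n \<in> ring_hom R (matrix_ring R n)"
proof -
  interpret ring R by fact
  let ?S = "matrix_ring R n"
  show ?thesis
  proof (rule ring_hom_memI)
    fix a b assume ab: "a \<in> carrier R" "b \<in> carrier R"
    show "scalar_matrix R n (a \<otimes> b) = scalar_matrix R n a \<otimes>\<^bsub>?S\<^esub> scalar_matrix R n b"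
    proof (rule eq_matI)
      fix i j assume "i < dim_row (scalar_matrix R n a \<otimes>\<^bsub>?S\<^esub> scalar_matrix R n b)"
        "j < dim_col (scalar_matrix R n a \<otimes>\<^bsub>?S\<^esub> scalar_matrix R n b)"
      then have ij: "i < n" "j < n" by (simp_all add: matrix_ring_simps)
      have "(scalar_matrix R n a \<otimes>\<^bsub>?S\<^esub> scalar_matrix R n b) $$ (i,j)
          = (\<Oplus>k\<in>{..<n}. (if i = k then a else \<zero>) \<otimes> (if k = j then b else \<zero>))"
        using ij ab by (auto simp: matrix_ring_simps scalar_matrix_def intro!: add.finprod_cong')
      also have "\<dots> = a \<otimes> (if i = j then b else \<zero>)"
        using ij ab by (subst finsum_scalar_left) auto
      also have "\<dots> = scalar_matrix R n (a \<otimes> b) $$ (i,j)"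
        using ij ab by (simp add: scalar_matrix_def)
      finally show "scalar_matrix R n (a \<otimes> b) $$ (i,j)
          = (scalar_matrix R n a \<otimes>\<^bsub>?S\<^esub> scalar_matrix R n b) $$ (i,j)" ..
    qed (simp_all add: matrix_ring_simps scalar_matrix_def)
  qed (auto simp: matrix_ring_carrier_iff matrix_ring_simps scalar_matrix_def intro!: eq_matI)
qed

end

theory Submission
  imports Defs
begin

text \<open>Heavy separability is only tested on the left regular module \<open>S\<close>. There the maps \<open>P\<close>
  amount to a map \<open>c\<close> from the \<open>R\<close>-linear endomorphisms of \<open>S\<close> to \<open>S\<close>, namely
  \<open>c f = P f 1\<close>, because an \<open>S\<close>-linear endomorphism of \<open>S\<close> is right multiplication by its value
  at \<open>1\<close>. As right multiplications compose in reverse order, \<open>c (f \<circ> g) = c g c f\<close>, and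
  \<open>c\<close> sends right multiplication by \<open>t\<close> to \<open>t\<close>
  (\<open>h_separable_ext_antimultiplicative_retraction\<close>).

  If \<open>s\<close> centralises the image of \<open>R\<close>, then left multiplication \<open>\<lambda>\<^sub>s\<close> is \<open>R\<close>-linear and
  commutes with all right multiplications, so \<open>c \<lambda>\<^sub>s\<close> is central in \<open>S\<close>. For matrix units
  \<open>E\<^sub>i\<^sub>j\<close> of \<open>S = M\<^sub>n(R)\<close> with \<open>n \<ge> 2\<close>, the products \<open>E\<^sub>i\<^sub>j E\<^sub>j\<^sub>i = E\<^sub>i\<^sub>i\<close> and
  \<open>E\<^sub>j\<^sub>i E\<^sub>i\<^sub>j = E\<^sub>j\<^sub>j\<close> are therefore not told apart by \<open>c\<close>, while \<open>E\<^sub>i\<^sub>i E\<^sub>j\<^sub>j = 0\<close>;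
  so the images of the \<open>E\<^sub>i\<^sub>i\<close> vanish.

  If \<open>c\<close> were known to be additive, \<open>1 = \<Sum> E\<^sub>i\<^sub>i\<close> would now give \<open>1 = 0\<close>. Additivity of \<open>P\<close> comes
  from its compatibility with direct sums, and the regular module already is the direct sum of its
  columns, so no further module has to be considered. Concretely, let \<open>D\<close> replace the off-diagonal
  entries of a matrix by \<open>0\<close>. On the \<open>j\<close>-th column \<open>D\<close> acts as left multiplication by
  \<open>E\<^sub>j\<^sub>j\<close>, so \<open>E\<^sub>j\<^sub>j c D = E\<^sub>j\<^sub>j c \<lambda>\<^sub>E\<^sub>j\<^sub>j = 0\<close> for all \<open>j\<close> and \<open>c D = 0\<close>. On the other hand, copying
  column \<open>0\<close> into all columns, applying \<open>D\<close>, and adding up all columns into column \<open>0\<close> restores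
  column \<open>0\<close> and clears the others. The outer two steps are right multiplications by some \<open>a\<close> and
  \<open>b\<close> and the composite is right multiplication by \<open>E\<^sub>0\<^sub>0\<close>, whence
  \<open>E\<^sub>0\<^sub>0 = a c D b = 0\<close>, that is, \<open>1 = 0\<close> in \<open>R\<close>.\<close>

section \<open>The retraction onto right multiplications\<close>

definition scalar_linear ::
  "('r, 'c) ring_scheme \<Rightarrow> ('s, 'd) ring_scheme \<Rightarrow> ('r \<Rightarrow> 's) \<Rightarrow> ('s \<Rightarrow> 's) \<Rightarrow> bool" where
  "scalar_linear R S \<phi> f \<longleftrightarrow> f \<in> carrier S \<rightarrow> carrier S \<and>
     (\<forall>x\<in>carrier S. \<forall>y\<in>carrier S. f (x \<oplus>\<^bsub>S\<^esub> y) = f x \<oplus>\<^bsub>S\<^esub> f y) \<and>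
     (\<forall>a\<in>carrier R. \<forall>x\<in>carrier S. f (\<phi> a \<otimes>\<^bsub>S\<^esub> x) = \<phi> a \<otimes>\<^bsub>S\<^esub> f x)"

lemma scalar_linear_comp:
  "scalar_linear R S \<phi> f \<Longrightarrow> scalar_linear R S \<phi> g \<Longrightarrow> scalar_linear R S \<phi> (f \<circ> g)"
  by (auto simp: scalar_linear_def Pi_iff)

lemma scalar_linear_right_mult:
  assumes "ring S" "\<phi> \<in> ring_hom R S" "t \<in> carrier S"
  shows "scalar_linear R S \<phi> (\<lambda>x. x \<otimes>\<^bsub>S\<^esub> t)"
proof -
  interpret S: ring S by fact
  show ?thesis
    using assms(2,3) by (auto simp: scalar_linear_def S.l_distr S.m_assoc ring_hom_closed)
qed

lemma scalar_linear_left_mult: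
  assumes "ring S" "\<phi> \<in> ring_hom R S" "s \<in> carrier S"
    and "\<And>a. a \<in> carrier R \<Longrightarrow> s \<otimes>\<^bsub>S\<^esub> \<phi> a = \<phi> a \<otimes>\<^bsub>S\<^esub> s"
  shows "scalar_linear R S \<phi> (\<lambda>x. s \<otimes>\<^bsub>S\<^esub> x)"
proof -
  interpret S: ring S by fact
  have "s \<otimes>\<^bsub>S\<^esub> (\<phi> a \<otimes>\<^bsub>S\<^esub> x) = \<phi> a \<otimes>\<^bsub>S\<^esub> (s \<otimes>\<^bsub>S\<^esub> x)" if "a \<in> carrier R" "x \<in> carrier S" for a x
    using that assms(3,4) ring_hom_closed[OF assms(2)] by (metis S.m_assoc)
  then show ?thesis
    using assms(2,3) by (auto simp: scalar_linear_def S.r_distr)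
qed

text \<open>The left regular module need not live in the universe type; an injection \<open>e\<close> carries it
  there.\<close>

definition regular_copy :: "('s \<Rightarrow> 'm) \<Rightarrow> ('s, 'd) ring_scheme \<Rightarrow> ('s, 'm) module" where
  "regular_copy e S = (let d = inv_into (carrier S) e in
     \<lparr>carrier = e ` carrier S,
      mult = (\<lambda>x y. e (d x \<otimes>\<^bsub>S\<^esub> d y)), one = e \<one>\<^bsub>S\<^esub>,
      zero = e \<zero>\<^bsub>S\<^esub>, add = (\<lambda>x y. e (d x \<oplus>\<^bsub>S\<^esub> d y)),
      smult = (\<lambda>a x. e (a \<otimes>\<^bsub>S\<^esub> d x))\<rparr>)"

lemma regular_copy_simps:
  assumes "inj_on e (carrier S)"
  shows "carrier (regular_copy e S) = e ` carrier S"
    and "zero (regular_copy e S) = e \<zero>\<^bsub>S\<^esub>"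
    and "\<lbrakk>x \<in> carrier S; y \<in> carrier S\<rbrakk> \<Longrightarrow> add (regular_copy e S) (e x) (e y) = e (x \<oplus>\<^bsub>S\<^esub> y)"
    and "x \<in> carrier S \<Longrightarrow> smult (regular_copy e S) a (e x) = e (a \<otimes>\<^bsub>S\<^esub> x)"
  using assms by (simp_all add: regular_copy_def Let_def)

lemma left_module_regular_copy:
  assumes "ring S" "inj_on e (carrier S)"
  shows "left_module S (regular_copy e S)"
proof -
  interpret S: ring S by fact
  note [simp] = regular_copy_simps[OF assms(2)]
  have inv: "\<exists>y\<in>carrier S. e (y \<oplus>\<^bsub>S\<^esub> x) = e \<zero>\<^bsub>S\<^esub>" if "x \<in> carrier S" for x
    using S.l_neg[OF that] S.a_inv_closed[OF that] by metis
  have "abelian_group (regular_copy e S)"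
    by (rule abelian_groupI) (use inv in \<open>auto simp: S.a_ac\<close>)
  then show ?thesis
    by (auto simp: left_module_def left_module_axioms_def S.ring_axioms
        S.l_distr S.r_distr S.m_assoc)
qed

definition transport_map :: "('s \<Rightarrow> 'm) \<Rightarrow> 's set \<Rightarrow> ('s \<Rightarrow> 's) \<Rightarrow> 'm \<Rightarrow> 'm" where
  "transport_map e A f = (\<lambda>y\<in>e ` A. e (f (inv_into A e y)))"

lemma transport_map_apply:
  "inj_on e A \<Longrightarrow> x \<in> A \<Longrightarrow> transport_map e A f (e x) = e (f x)"
  by (simp add: transport_map_def)

lemma transport_map_comp:
  assumes "inj_on e A" "g \<in> A \<rightarrow> A"
  shows "transport_map e A (f \<circ> g) = compose (e ` A) (transport_map e A f) (transport_map e A g)"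
proof
  fix y
  show "transport_map e A (f \<circ> g) y
      = compose (e ` A) (transport_map e A f) (transport_map e A g) y"
  proof (cases "y \<in> e ` A")
    case True
    then obtain x where "x \<in> A" "y = e x" by blast
    then show ?thesis
      using assms funcset_mem[OF assms(2)] by (simp add: compose_def transport_map_apply)
  qed (simp add: compose_def transport_map_def)
qed

lemma transport_map_lmod_hom:
  assumes "ring S" "\<phi> \<in> ring_hom R S" "inj_on e (carrier S)" "scalar_linear R S \<phi> f"
  shows "transport_map e (carrier S) f
    \<in> lmod_hom R (restrict_module \<phi> (regular_copy e S)) (restrict_module \<phi> (regular_copy e S))"
proof -
  interpret S: ring S by fact
  note [simp] = regular_copy_simps[OF assms(3)] transport_map_apply[OF assms(3)]
  have f: "f x \<in> carrier S" if "x \<in> carrier S" for x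
    using assms(4) that by (auto simp: scalar_linear_def)
  have "transport_map e (carrier S) f \<in> extensional (e ` carrier S)"
    by (simp add: transport_map_def)
  then show ?thesis
    using assms(4) ring_hom_closed[OF assms(2)] f
    by (auto simp: lmod_hom_def restrict_module_def PiE_iff scalar_linear_def)
qed

lemma transport_right_mult_lmod_hom:
  assumes "ring S" "inj_on e (carrier S)" "t \<in> carrier S"
  shows "transport_map e (carrier S) (\<lambda>x. x \<otimes>\<^bsub>S\<^esub> t)
    \<in> lmod_hom S (regular_copy e S) (regular_copy e S)"
proof -
  interpret S: ring S by fact
  note [simp] = regular_copy_simps[OF assms(2)] transport_map_apply[OF assms(2)]
  have "transport_map e (carrier S) (\<lambda>x. x \<otimes>\<^bsub>S\<^esub> t) \<in> extensional (e ` carrier S)"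
    by (simp add: transport_map_def)
  then show ?thesis
    using assms(3) by (auto simp: lmod_hom_def PiE_iff S.l_distr S.m_assoc)
qed

text \<open>The map \<open>c\<close> is evaluation of \<open>P f\<close> at \<open>1\<close>: by \<open>S\<close>-linearity
  \<open>P f (P g 1) = P g 1 \<cdot> P f 1\<close>, so functoriality of \<open>P\<close> turns into reversal of products, and the
  retraction property of \<open>P\<close> applies to right multiplications because they are \<open>S\<close>-linear.\<close>

lemma h_separable_ext_antimultiplicative_retraction:
  fixes R :: "('r, 'c) ring_scheme" and S :: "('s, 'd) ring_scheme" and e :: "'s \<Rightarrow> 'm"
  assumes "ring S" "\<phi> \<in> ring_hom R S" "inj_on e (carrier S)"
    and "h_separable_ext TYPE('m) R S \<phi>"
  obtains c where
    "\<And>f. scalar_linear R S \<phi> f \<Longrightarrow> c f \<in> carrier S"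
    "\<And>f g. (\<And>x. x \<in> carrier S \<Longrightarrow> f x = g x) \<Longrightarrow> c f = c g"
    "\<And>f g. scalar_linear R S \<phi> f \<Longrightarrow> scalar_linear R S \<phi> g \<Longrightarrow> c (f \<circ> g) = c g \<otimes>\<^bsub>S\<^esub> c f"
    "\<And>t. t \<in> carrier S \<Longrightarrow> c (\<lambda>x. x \<otimes>\<^bsub>S\<^esub> t) = t"
proof -
  interpret S: ring S by fact
  let ?X = "regular_copy e S" and ?T = "transport_map e (carrier S)"
  let ?d = "inv_into (carrier S) e"
  note X = regular_copy_simps[OF assms(3)]
  have obj: "?X \<in> obj (LMod S)"
    using left_module_regular_copy[OF assms(1,3)] by (simp add: LMod_def)
  let ?B = "LMod S :: (('s, 'm) module, 'm \<Rightarrow> 'm) cat"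
    and ?H = "\<lambda>M N. lmod_hom R (restrict_module \<phi> M) (restrict_module \<phi> N)"
  have "\<exists>P. (\<forall>M\<in>obj ?B. \<forall>N\<in>obj ?B. \<forall>f\<in>?H M N. P M N f \<in> lmod_hom S M N) \<and>
      (\<forall>M\<in>obj ?B. \<forall>N\<in>obj ?B. \<forall>f\<in>lmod_hom S M N. P M N f = f) \<and>
      (\<forall>L\<in>obj ?B. \<forall>M\<in>obj ?B. \<forall>N\<in>obj ?B. \<forall>g\<in>?H L M. \<forall>f\<in>?H M N.
        P L N (compose (carrier L) f g) = compose (carrier L) (P M N f) (P L M g))"
  proof -
    have simps: "arr (LMod S) = lmod_hom S" "arr (LMod R) = lmod_hom R"
        "fobj (restrict_scalars \<phi>) = restrict_module \<phi>" "farr (restrict_scalars \<phi>) M N f = f"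
        "comp (LMod S) L M N g f = compose (carrier L) g f"
        "comp (LMod R) (restrict_module \<phi> L) M' N' g f = compose (carrier L) g f"
      for L M N :: "('s, 'm) module" and M' N' :: "('r, 'm) module" and f g
      by (simp_all add: LMod_def restrict_scalars_def restrict_module_def)
    show ?thesis
      using assms(4)[unfolded h_separable_ext_def h_separable_functor_def simps]
      by (elim conjE exE) (intro exI conjI; assumption)
  qed
  then obtain P where P: "\<forall>M\<in>obj ?B. \<forall>N\<in>obj ?B. \<forall>f\<in>?H M N. P M N f \<in> lmod_hom S M N"
      "\<forall>M\<in>obj ?B. \<forall>N\<in>obj ?B. \<forall>f\<in>lmod_hom S M N. P M N f = f"
      "\<forall>L\<in>obj ?B. \<forall>M\<in>obj ?B. \<forall>N\<in>obj ?B. \<forall>g\<in>?H L M. \<forall>f\<in>?H M N.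
        P L N (compose (carrier L) f g) = compose (carrier L) (P M N f) (P L M g)"
    by (elim exE conjE)
  note P_hom = P(1)[rule_format, OF obj obj] and P_retr = P(2)[rule_format, OF obj obj]
    and P_comp = P(3)[rule_format, OF obj obj obj, unfolded X(1)]
  define c where "c f = ?d (P ?X ?X (?T f) (e \<one>\<^bsub>S\<^esub>))" for f
  have hom: "P ?X ?X (?T f) \<in> lmod_hom S ?X ?X" if "scalar_linear R S \<phi> f" for f
    using P_hom transport_map_lmod_hom[OF assms(1-3) that] by blast
  have c: "c f \<in> carrier S \<and> P ?X ?X (?T f) (e \<one>\<^bsub>S\<^esub>) = e (c f)" if "scalar_linear R S \<phi> f" for f
  proof -
    have "P ?X ?X (?T f) (e \<one>\<^bsub>S\<^esub>) \<in> e ` carrier S"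
      using hom[OF that] by (auto simp: lmod_hom_def X)
    then show ?thesis
      by (simp add: c_def inv_into_into f_inv_into_f)
  qed
  have P_apply: "P ?X ?X (?T f) (e x) = e (x \<otimes>\<^bsub>S\<^esub> c f)"
    if "scalar_linear R S \<phi> f" "x \<in> carrier S" for f x
  proof -
    have "P ?X ?X (?T f) (x \<odot>\<^bsub>?X\<^esub> e \<one>\<^bsub>S\<^esub>) = x \<odot>\<^bsub>?X\<^esub> P ?X ?X (?T f) (e \<one>\<^bsub>S\<^esub>)"
      using hom[OF that(1)] that(2) by (auto simp: lmod_hom_def X(1))
    then show ?thesis using c[OF that(1)] that(2) by (simp add: X)
  qed
  show ?thesis
  proof
    fix f assume "scalar_linear R S \<phi> f"
    then show "c f \<in> carrier S" using c by blast
  next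
    fix f g :: "'s \<Rightarrow> 's" assume "\<And>x. x \<in> carrier S \<Longrightarrow> f x = g x"
    then have "?T f = ?T g" by (auto simp: transport_map_def inv_into_into)
    then show "c f = c g" by (simp add: c_def)
  next
    fix f g assume fg: "scalar_linear R S \<phi> f" "scalar_linear R S \<phi> g"
    have "P ?X ?X (?T (f \<circ> g)) = compose (e ` carrier S) (P ?X ?X (?T f)) (P ?X ?X (?T g))"
      using fg transport_map_lmod_hom[OF assms(1-3)]
      by (subst transport_map_comp[OF assms(3)]) (auto simp: scalar_linear_def intro!: P_comp)
    then have "P ?X ?X (?T (f \<circ> g)) (e \<one>\<^bsub>S\<^esub>) = P ?X ?X (?T f) (P ?X ?X (?T g) (e \<one>\<^bsub>S\<^esub>))"
      by (simp add: compose_def)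
    then have "e (c (f \<circ> g)) = e (c g \<otimes>\<^bsub>S\<^esub> c f)"
      using fg c scalar_linear_comp[OF fg] P_apply by simp
    then show "c (f \<circ> g) = c g \<otimes>\<^bsub>S\<^esub> c f"
      using fg c scalar_linear_comp[OF fg] assms(3) by (simp add: inj_on_eq_iff)
  next
    fix t assume t: "t \<in> carrier S"
    have "P ?X ?X (?T (\<lambda>x. x \<otimes>\<^bsub>S\<^esub> t)) = ?T (\<lambda>x. x \<otimes>\<^bsub>S\<^esub> t)"
      by (rule P_retr[OF transport_right_mult_lmod_hom[OF assms(1,3) t]])
    then show "c (\<lambda>x. x \<otimes>\<^bsub>S\<^esub> t) = t"
      using t assms(3) by (simp add: c_def transport_map_apply)
  qed
qed

section \<open>Matrix units\<close>

definition matrix_unit :: "('r, 'c) ring_scheme \<Rightarrow> nat \<Rightarrow> nat \<Rightarrow> nat \<Rightarrow> 'r mat" where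
  "matrix_unit R n i j =
     mat n n (\<lambda>(k,l). if k = i then if l = j then \<one>\<^bsub>R\<^esub> else \<zero>\<^bsub>R\<^esub> else \<zero>\<^bsub>R\<^esub>)"

context ring
begin

lemma matrix_unit_closed [simp]: "matrix_unit R n i j \<in> carrier (matrix_ring R n)"
  by (simp add: matrix_unit_def matrix_ring_carrier_iff)

lemma matrix_unit_mult_left:
  assumes "A \<in> carrier (matrix_ring R n)" "i < n" "j < n"
  shows "matrix_unit R n i j \<otimes>\<^bsub>matrix_ring R n\<^esub> A
    = mat n n (\<lambda>(k,l). if k = i then A $$ (j,l) else \<zero>)"
proof (rule eq_matI)
  let ?B = "mat n n (\<lambda>(k,l). if k = i then A $$ (j,l) else \<zero>)"
  fix k l assume "k < dim_row ?B" "l < dim_col ?B"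
  then have kl: "k < n" "l < n" by simp_all
  have A: "A $$ (m,l) \<in> carrier R" if "m < n" for m
    using assms(1) kl that by (simp add: matrix_ring_carrier_iff)
  have "(matrix_unit R n i j \<otimes>\<^bsub>matrix_ring R n\<^esub> A) $$ (k,l)
      = (\<Oplus>m\<in>{..<n}. (if j = m then if k = i then \<one> else \<zero> else \<zero>) \<otimes> A $$ (m,l))"
    using kl A by (auto simp: matrix_ring_simps matrix_unit_def intro!: add.finprod_cong')
  also have "\<dots> = (if k = i then \<one> else \<zero>) \<otimes> A $$ (j,l)"
    using assms A by (subst finsum_scalar_left) auto
  finally show "(matrix_unit R n i j \<otimes>\<^bsub>matrix_ring R n\<^esub> A) $$ (k,l) = ?B $$ (k,l)"
    using kl A assms by auto
qed (simp_all add: matrix_ring_simps)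

lemma matrix_unit_mult_right:
  assumes "A \<in> carrier (matrix_ring R n)" "i < n" "j < n"
  shows "A \<otimes>\<^bsub>matrix_ring R n\<^esub> matrix_unit R n i j
    = mat n n (\<lambda>(k,l). if l = j then A $$ (k,i) else \<zero>)"
proof (rule eq_matI)
  let ?B = "mat n n (\<lambda>(k,l). if l = j then A $$ (k,i) else \<zero>)"
  fix k l assume "k < dim_row ?B" "l < dim_col ?B"
  then have kl: "k < n" "l < n" by simp_all
  have A: "A $$ (k,m) \<in> carrier R" if "m < n" for m
    using assms(1) kl that by (simp add: matrix_ring_carrier_iff)
  have "(A \<otimes>\<^bsub>matrix_ring R n\<^esub> matrix_unit R n i j) $$ (k,l)
      = (\<Oplus>m\<in>{..<n}. A $$ (k,m) \<otimes> (if m = i then if l = j then \<one> else \<zero> else \<zero>))"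
    using kl A by (auto simp: matrix_ring_simps matrix_unit_def intro!: add.finprod_cong')
  also have "\<dots> = A $$ (k,i) \<otimes> (if l = j then \<one> else \<zero>)"
    using assms A by (subst finsum_scalar_right) auto
  finally show "(A \<otimes>\<^bsub>matrix_ring R n\<^esub> matrix_unit R n i j) $$ (k,l) = ?B $$ (k,l)"
    using kl A assms by auto
qed (simp_all add: matrix_ring_simps)

lemma matrix_unit_mult:
  assumes "i < n" "j < n" "k < n" "l < n"
  shows "matrix_unit R n i j \<otimes>\<^bsub>matrix_ring R n\<^esub> matrix_unit R n k l
    = (if j = k then matrix_unit R n i l else \<zero>\<^bsub>matrix_ring R n\<^esub>)"
  unfolding matrix_unit_mult_left[OF matrix_unit_closed assms(1,2)] matrix_ring_simps(3)
  using assms by (auto simp: matrix_unit_def intro!: eq_matI)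

lemma scalar_matrix_closed:
  "r \<in> carrier R \<Longrightarrow> scalar_matrix R n r \<in> carrier (matrix_ring R n)"
  by (simp add: scalar_matrix_def matrix_ring_carrier_iff)

lemma scalar_matrix_mult_left:
  assumes "A \<in> carrier (matrix_ring R n)" "r \<in> carrier R"
  shows "scalar_matrix R n r \<otimes>\<^bsub>matrix_ring R n\<^esub> A = mat n n (\<lambda>(k,l). r \<otimes> A $$ (k,l))"
proof (rule eq_matI)
  let ?B = "mat n n (\<lambda>(k,l). r \<otimes> A $$ (k,l))"
  fix k l assume "k < dim_row ?B" "l < dim_col ?B"
  then have kl: "k < n" "l < n" by simp_all
  have A: "A $$ (m,l) \<in> carrier R" if "m < n" for m
    using assms(1) kl that by (simp add: matrix_ring_carrier_iff)
  have "(scalar_matrix R n r \<otimes>\<^bsub>matrix_ring R n\<^esub> A) $$ (k,l)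
      = (\<Oplus>m\<in>{..<n}. (if k = m then r else \<zero>) \<otimes> A $$ (m,l))"
    using kl A assms by (auto simp: matrix_ring_simps scalar_matrix_def intro!: add.finprod_cong')
  also have "\<dots> = r \<otimes> A $$ (k,l)"
    using assms A kl by (subst finsum_scalar_left) auto
  finally show "(scalar_matrix R n r \<otimes>\<^bsub>matrix_ring R n\<^esub> A) $$ (k,l) = ?B $$ (k,l)"
    using kl by simp
qed (simp_all add: matrix_ring_simps)

lemma matrix_unit_commutes_scalar_matrix:
  assumes "r \<in> carrier R" "i < n" "j < n"
  shows "matrix_unit R n i j \<otimes>\<^bsub>matrix_ring R n\<^esub> scalar_matrix R n r
    = scalar_matrix R n r \<otimes>\<^bsub>matrix_ring R n\<^esub> matrix_unit R n i j"
  using assms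
  by (auto simp: matrix_unit_mult_left scalar_matrix_closed scalar_matrix_mult_left)
    (auto simp: scalar_matrix_def matrix_unit_def intro!: eq_matI)

lemma eq_zero_if_matrix_units_annihilate:
  assumes "A \<in> carrier (matrix_ring R n)"
    and "\<And>i. i < n \<Longrightarrow> matrix_unit R n i i \<otimes>\<^bsub>matrix_ring R n\<^esub> A = \<zero>\<^bsub>matrix_ring R n\<^esub>"
  shows "A = \<zero>\<^bsub>matrix_ring R n\<^esub>"
proof (rule eq_matI)
  fix i j
  assume "i < dim_row \<zero>\<^bsub>matrix_ring R n\<^esub>" "j < dim_col \<zero>\<^bsub>matrix_ring R n\<^esub>"
  then have ij: "i < n" "j < n" by (simp_all add: matrix_ring_simps)
  have "A $$ (i,j) = (matrix_unit R n i i \<otimes>\<^bsub>matrix_ring R n\<^esub> A) $$ (i,j)"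
    using assms(1) ij by (simp add: matrix_unit_mult_left)
  then show "A $$ (i,j) = \<zero>\<^bsub>matrix_ring R n\<^esub> $$ (i,j)"
    using assms(2) ij by simp
qed (use assms(1) in \<open>auto simp: matrix_ring_carrier_iff matrix_ring_simps\<close>)

section \<open>The diagonal part of a matrix\<close>

definition diagonal_part :: "nat \<Rightarrow> 'a mat \<Rightarrow> 'a mat" where
  "diagonal_part n A = mat n n (\<lambda>(i,j). if i = j then A $$ (i,j) else \<zero>)"

lemma scalar_linear_diagonal_part:
  "scalar_linear R (matrix_ring R n) (scalar_matrix R n) (diagonal_part n)"
proof -
  have closed: "diagonal_part n A \<in> carrier (matrix_ring R n)"
    if "A \<in> carrier (matrix_ring R n)" for A
    using that by (auto simp: diagonal_part_def matrix_ring_carrier_iff)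
  moreover have "diagonal_part n (A \<oplus>\<^bsub>matrix_ring R n\<^esub> B)
      = diagonal_part n A \<oplus>\<^bsub>matrix_ring R n\<^esub> diagonal_part n B" for A B
    by (rule eq_matI) (auto simp: diagonal_part_def matrix_ring_simps(4))
  moreover have "diagonal_part n (scalar_matrix R n r \<otimes>\<^bsub>matrix_ring R n\<^esub> A)
      = scalar_matrix R n r \<otimes>\<^bsub>matrix_ring R n\<^esub> diagonal_part n A"
    if "r \<in> carrier R" "A \<in> carrier (matrix_ring R n)" for r A
    unfolding scalar_matrix_mult_left[OF that(2,1)]
      scalar_matrix_mult_left[OF closed[OF that(2)] that(1)]
    by (rule eq_matI) (use that in \<open>auto simp: diagonal_part_def\<close>)
  ultimately show ?thesis
    unfolding scalar_linear_def by blast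
qed

lemma diagonal_part_on_column:
  assumes "A \<in> carrier (matrix_ring R n)" "j < n"
  shows "diagonal_part n (A \<otimes>\<^bsub>matrix_ring R n\<^esub> matrix_unit R n j j)
    = matrix_unit R n j j \<otimes>\<^bsub>matrix_ring R n\<^esub> (A \<otimes>\<^bsub>matrix_ring R n\<^esub> matrix_unit R n j j)"
proof -
  interpret S: ring "matrix_ring R n" by (rule ring_matrix_ring) (rule ring_axioms)
  note column = matrix_unit_mult_right[OF assms(1,2,2)]
  have closed: "A \<otimes>\<^bsub>matrix_ring R n\<^esub> matrix_unit R n j j \<in> carrier (matrix_ring R n)"
    using assms(1) by simp
  show ?thesis
    unfolding column matrix_unit_mult_left[OF closed[unfolded column] assms(2,2)]
    using assms(2) by (auto simp: diagonal_part_def intro!: eq_matI)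
qed

text \<open>The matrix \<open>a\<close>, with ones in row \<open>0\<close>, copies column \<open>0\<close> into every column; the matrix \<open>b\<close>,
  with ones in column \<open>0\<close>, adds all columns into column \<open>0\<close>.\<close>

lemma diagonal_part_sandwich:
  assumes "n > 0"
  shows "\<exists>a\<in>carrier (matrix_ring R n). \<exists>b\<in>carrier (matrix_ring R n).
    \<forall>A\<in>carrier (matrix_ring R n).
      diagonal_part n (A \<otimes>\<^bsub>matrix_ring R n\<^esub> a) \<otimes>\<^bsub>matrix_ring R n\<^esub> b
      = A \<otimes>\<^bsub>matrix_ring R n\<^esub> matrix_unit R n 0 0"
proof -
  let ?S = "matrix_ring R n"
  let ?a = "mat n n (\<lambda>(i,j). if i = 0 then \<one> else \<zero>)"
  let ?b = "mat n n (\<lambda>(i,j). if j = 0 then \<one> else \<zero>)"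
  have ab: "?a \<in> carrier ?S" "?b \<in> carrier ?S"
    by (simp_all add: matrix_ring_carrier_iff)
  have "diagonal_part n (A \<otimes>\<^bsub>?S\<^esub> ?a) \<otimes>\<^bsub>?S\<^esub> ?b = A \<otimes>\<^bsub>?S\<^esub> matrix_unit R n 0 0"
    if A: "A \<in> carrier ?S" for A
  proof -
    have entry: "A $$ (i,j) \<in> carrier R" if "i < n" "j < n" for i j
      using A that by (simp add: matrix_ring_carrier_iff)
    have Aa: "A \<otimes>\<^bsub>?S\<^esub> ?a = mat n n (\<lambda>(i,j). A $$ (i,0))"
    proof (rule eq_matI)
      fix i j assume "i < dim_row (mat n n (\<lambda>(i,j). A $$ (i,0)))"
        "j < dim_col (mat n n (\<lambda>(i,j). A $$ (i,0)))"
      then have ij: "i < n" "j < n" by simp_all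
      have "(A \<otimes>\<^bsub>?S\<^esub> ?a) $$ (i,j) = (\<Oplus>k\<in>{..<n}. A $$ (i,k) \<otimes> (if k = 0 then \<one> else \<zero>))"
        using ij entry by (auto simp: matrix_ring_simps intro!: add.finprod_cong')
      also have "\<dots> = A $$ (i,0) \<otimes> \<one>"
        using ij entry assms by (subst finsum_scalar_right) auto
      finally show "(A \<otimes>\<^bsub>?S\<^esub> ?a) $$ (i,j) = mat n n (\<lambda>(i,j). A $$ (i,0)) $$ (i,j)"
        using ij entry assms by simp
    qed (simp_all add: matrix_ring_simps)
    show ?thesis
      unfolding Aa matrix_unit_mult_right[OF A assms assms]
    proof (rule eq_matI)
      let ?D = "diagonal_part n (mat n n (\<lambda>(i,j). A $$ (i,0)))"
      let ?C = "mat n n (\<lambda>(k,l). if l = 0 then A $$ (k,0) else \<zero>)"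
      fix i j assume "i < dim_row ?C" "j < dim_col ?C"
      then have ij: "i < n" "j < n" by simp_all
      have "(?D \<otimes>\<^bsub>?S\<^esub> ?b) $$ (i,j)
          = (\<Oplus>k\<in>{..<n}. (if i = k then A $$ (i,0) else \<zero>) \<otimes> (if j = 0 then \<one> else \<zero>))"
        unfolding matrix_ring_simps(1) index_mat(1)[OF ij] split
        by (intro add.finprod_cong') (use ij entry assms in \<open>auto simp: diagonal_part_def\<close>)
      also have "\<dots> = A $$ (i,0) \<otimes> (if j = 0 then \<one> else \<zero>)"
        using ij entry assms by (subst finsum_scalar_left) auto
      finally show "(?D \<otimes>\<^bsub>?S\<^esub> ?b) $$ (i,j) = ?C $$ (i,j)"
        using ij entry assms by simp
    qed (simp_all add: matrix_ring_simps)
  qed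
  then show ?thesis using ab by blast
qed

section \<open>Matrix rings of size at least two\<close>

text \<open>Composed with an embedding of the finite sequences over \<open>R\<close>, this places the regular module of
  the matrix ring in a large universe.\<close>

lemma inj_on_matrix_entries:
  "inj_on (\<lambda>A. map (($$) A) (List.product [0..<n] [0..<n])) (carrier (matrix_ring R n))"
  by (rule inj_onI) (auto simp: matrix_ring_carrier_iff intro!: eq_matI)

text \<open>Centrality and multiplicativity kill the images of the idempotents \<open>E\<^sub>i\<^sub>i\<close>; passing from there
  to \<open>1 = 0\<close> needs some additivity of \<open>c\<close>, which is obtained by
  evaluating \<open>c\<close> on the diagonal part.\<close>

lemma one_eq_zero_if_antimultiplicative_retraction:
  assumes "n \<ge> 2"
    and lin_closed: "\<And>f. scalar_linear R (matrix_ring R n) (scalar_matrix R n) f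
      \<Longrightarrow> c f \<in> carrier (matrix_ring R n)"
    and cong: "\<And>f g. (\<And>x. x \<in> carrier (matrix_ring R n) \<Longrightarrow> f x = g x) \<Longrightarrow> c f = c g"
    and antimult: "\<And>f g. scalar_linear R (matrix_ring R n) (scalar_matrix R n) f
      \<Longrightarrow> scalar_linear R (matrix_ring R n) (scalar_matrix R n) g
      \<Longrightarrow> c (f \<circ> g) = c g \<otimes>\<^bsub>matrix_ring R n\<^esub> c f"
    and retract: "\<And>t. t \<in> carrier (matrix_ring R n) \<Longrightarrow> c (\<lambda>x. x \<otimes>\<^bsub>matrix_ring R n\<^esub> t) = t"
  shows "\<one> = \<zero>"
proof -
  let ?S = "matrix_ring R n" and ?E = "matrix_unit R n"
  let ?\<phi> = "scalar_matrix R n"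
  interpret S: ring ?S by (rule ring_matrix_ring) (rule ring_axioms)
  have \<phi>: "?\<phi> \<in> ring_hom R ?S" by (rule scalar_matrix_ring_hom) (rule ring_axioms)
  define lam where "lam s = (\<lambda>x. s \<otimes>\<^bsub>?S\<^esub> x)" for s
  define rho where "rho t = (\<lambda>x. x \<otimes>\<^bsub>?S\<^esub> t)" for t
  have rho: "scalar_linear R ?S ?\<phi> (rho t)" "c (rho t) = t" if "t \<in> carrier ?S" for t
    using that retract scalar_linear_right_mult[OF S.ring_axioms \<phi>] by (simp_all add: rho_def)
  have lam: "scalar_linear R ?S ?\<phi> (lam (?E i j))" if "i < n" "j < n" for i j
    unfolding lam_def using that
    by (intro scalar_linear_left_mult[OF S.ring_axioms \<phi>])
      (simp_all add: matrix_unit_commutes_scalar_matrix)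
  define p where "p i j = c (lam (?E i j))" for i j
  have p_closed: "p i j \<in> carrier ?S" if "i < n" "j < n" for i j
    using lin_closed lam that by (simp add: p_def)
  have p_central: "p i j \<otimes>\<^bsub>?S\<^esub> t = t \<otimes>\<^bsub>?S\<^esub> p i j" if "i < n" "j < n" "t \<in> carrier ?S" for i j t
  proof -
    have "p i j \<otimes>\<^bsub>?S\<^esub> t = c (rho t \<circ> lam (?E i j))"
      using that antimult[OF rho(1) lam] by (simp add: p_def rho(2))
    also have "\<dots> = c (lam (?E i j) \<circ> rho t)"
      by (rule cong) (use that in \<open>simp add: lam_def rho_def S.m_assoc\<close>)
    also have "\<dots> = t \<otimes>\<^bsub>?S\<^esub> p i j"
      using that antimult[OF lam rho(1)] by (simp add: p_def rho(2))
    finally show ?thesis .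
  qed
  have p_mult: "p k l \<otimes>\<^bsub>?S\<^esub> p i j = (if j = k then p i l else \<zero>\<^bsub>?S\<^esub>)"
    if "i < n" "j < n" "k < n" "l < n" for i j k l
  proof -
    have "p k l \<otimes>\<^bsub>?S\<^esub> p i j = c (lam (?E i j) \<circ> lam (?E k l))"
      using that antimult[OF lam lam] by (simp add: p_def)
    also have "\<dots> = c (lam (?E i j \<otimes>\<^bsub>?S\<^esub> ?E k l))"
      by (rule cong) (simp add: lam_def S.m_assoc)
    also have "\<dots> = (if j = k then p i l else c (lam \<zero>\<^bsub>?S\<^esub>))"
      using that by (simp add: matrix_unit_mult p_def)
    also have "c (lam \<zero>\<^bsub>?S\<^esub>) = c (rho \<zero>\<^bsub>?S\<^esub>)"
      by (rule cong) (simp add: lam_def rho_def)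
    also have "\<dots> = \<zero>\<^bsub>?S\<^esub>" by (simp add: rho(2))
    finally show ?thesis .
  qed
  (* E_ii and E_jj are the two products of E_ij and E_ji, so p_ii = p_jj by centrality; but
     orthogonal idempotents can only be equal if they vanish. *)
  have p_zero: "p i i = \<zero>\<^bsub>?S\<^esub>" if i: "i < n" for i
  proof -
    obtain j where j: "j < n" "j \<noteq> i"
    proof (cases "i = 0")
      case True
      then show ?thesis using that[of 1] assms(1) by simp
    next
      case False
      then show ?thesis using that[of 0] assms(1) by simp
    qed
    have "p i i = p j i \<otimes>\<^bsub>?S\<^esub> p i j" using p_mult[of i j j i] i j by simp
    also have "\<dots> = p i j \<otimes>\<^bsub>?S\<^esub> p j i" by (rule p_central) (use i j p_closed in auto)
    also have "\<dots> = p j j" using p_mult[of j i i j] i j by simp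
    finally have "p i i = p j j" .
    have "p i i = p i i \<otimes>\<^bsub>?S\<^esub> p i i" using p_mult[of i i i i] i by simp
    also have "\<dots> = p j j \<otimes>\<^bsub>?S\<^esub> p i i" by (simp only: \<open>p i i = p j j\<close>)
    also have "\<dots> = \<zero>\<^bsub>?S\<^esub>" using p_mult[of i i j j] i j by simp
    finally show ?thesis .
  qed
  have D: "scalar_linear R ?S ?\<phi> (diagonal_part n)" by (rule scalar_linear_diagonal_part)
  (* Precomposition with right multiplication by E_jj restricts to the j-th column, where the
     diagonal part is left multiplication by E_jj. *)
  have c_D: "c (diagonal_part n) = \<zero>\<^bsub>?S\<^esub>"
  proof (rule eq_zero_if_matrix_units_annihilate[OF lin_closed[OF D]])
    fix j assume j: "j < n"
    have "?E j j \<otimes>\<^bsub>?S\<^esub> c (diagonal_part n) = c (diagonal_part n \<circ> rho (?E j j))"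
      using antimult[OF D rho(1)] by (simp add: rho(2))
    also have "\<dots> = c (lam (?E j j) \<circ> rho (?E j j))"
      by (rule cong) (use j in \<open>simp add: lam_def rho_def diagonal_part_on_column\<close>)
    also have "\<dots> = ?E j j \<otimes>\<^bsub>?S\<^esub> p j j"
      using antimult[OF lam rho(1)] j by (simp add: rho(2) p_def)
    finally show "?E j j \<otimes>\<^bsub>?S\<^esub> c (diagonal_part n) = \<zero>\<^bsub>?S\<^esub>"
      using p_zero j by simp
  qed
  obtain a b where ab: "a \<in> carrier ?S" "b \<in> carrier ?S"
    and sandwich: "\<forall>A\<in>carrier ?S.
      diagonal_part n (A \<otimes>\<^bsub>?S\<^esub> a) \<otimes>\<^bsub>?S\<^esub> b = A \<otimes>\<^bsub>?S\<^esub> ?E 0 0"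
    using diagonal_part_sandwich[OF less_le_trans[OF pos2 assms(1)]] by blast
  have "?E 0 0 = c (rho (?E 0 0))" by (simp add: rho(2))
  also have "\<dots> = c (rho b \<circ> (diagonal_part n \<circ> rho a))"
    by (rule cong) (simp add: rho_def sandwich)
  also have "\<dots> = a \<otimes>\<^bsub>?S\<^esub> c (diagonal_part n) \<otimes>\<^bsub>?S\<^esub> b"
    unfolding antimult[OF rho(1)[OF ab(2)] scalar_linear_comp[OF D rho(1)[OF ab(1)]]]
      antimult[OF D rho(1)[OF ab(1)]] rho(2)[OF ab(1)] rho(2)[OF ab(2)] ..
  also have "\<dots> = \<zero>\<^bsub>?S\<^esub>" unfolding c_D using ab by simp
  finally have "?E 0 0 = \<zero>\<^bsub>?S\<^esub>" .
  then have "?E 0 0 $$ (0,0) = \<zero>\<^bsub>?S\<^esub> $$ (0,0)" by simp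
  then show ?thesis using assms(1) by (simp add: matrix_unit_def matrix_ring_simps)
qed

end

theorem lemma3p11:
  fixes R :: "('r, 'c) ring_scheme" and n :: nat
  assumes "ring R"
    and "n \<ge> 1"
    and "large_universe TYPE('m) R"
    and "h_separable_ext TYPE('m) R (matrix_ring R n) (scalar_matrix R n)"
  shows "n = 1 \<or> carrier R = {\<zero>\<^bsub>R\<^esub>}"
proof (rule disjCI)
  interpret ring R by fact
  let ?S = "matrix_ring R n"
  let ?entries = "\<lambda>A :: 'r mat. map (($$) A) (List.product [0..<n] [0..<n])"
  assume "carrier R \<noteq> {\<zero>\<^bsub>R\<^esub>}"
  then have nonzero: "\<one>\<^bsub>R\<^esub> \<noteq> \<zero>\<^bsub>R\<^esub>" using one_zeroD by blast
  obtain e :: "'r list \<Rightarrow> 'm" where e: "inj_on e (lists (carrier R))"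
    using assms(3) by (auto simp: large_universe_def)
  have "?entries ` carrier ?S \<subseteq> lists (carrier R)"
    by (auto simp: matrix_ring_carrier_iff)
  then have inj: "inj_on (e \<circ> ?entries) (carrier ?S)"
    using inj_on_matrix_entries e by (blast intro: comp_inj_on inj_on_subset)
  show "n = 1"
  proof (rule ccontr)
    assume "n \<noteq> 1"
    then have n: "n \<ge> 2" using assms(2) by simp
    show False
    proof (rule h_separable_ext_antimultiplicative_retraction
        [OF ring_matrix_ring[OF assms(1)] scalar_matrix_ring_hom[OF assms(1)] inj assms(4)])
      fix c
      assume "\<And>f. scalar_linear R ?S (scalar_matrix R n) f \<Longrightarrow> c f \<in> carrier ?S"
        and "\<And>f g. (\<And>x. x \<in> carrier ?S \<Longrightarrow> f x = g x) \<Longrightarrow> c f = c g"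
        and "\<And>f g. scalar_linear R ?S (scalar_matrix R n) f
          \<Longrightarrow> scalar_linear R ?S (scalar_matrix R n) g \<Longrightarrow> c (f \<circ> g) = c g \<otimes>\<^bsub>?S\<^esub> c f"
        and "\<And>t. t \<in> carrier ?S \<Longrightarrow> c (\<lambda>x. x \<otimes>\<^bsub>?S\<^esub> t) = t"
      then have "\<one>\<^bsub>R\<^esub> = \<zero>\<^bsub>R\<^esub>" by (rule one_eq_zero_if_antimultiplicative_retraction[OF n])
      then show False using nonzero by contradiction
    qed
  qed
qed

end
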